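(* For any integer $k\geq 3$, $$\frac{1}{2\sqrt{k-1}}\geq c_{k}^{\ast}>\frac{1}{2\sqrt{k-1}+2}=\frac{1}{2\sqrt{k-1}}+O\left(k^{-1}\right),$$ where the $O$-term is as $k\to\infty$.
   Context: Graphs are finite, simple and undirected; the order of a graph is its number of vertices. For a graph $G$, $\lambda_i^{\ast}(G)$ denotes the $i$'th largest singular value of its adjacency matrix, i.e. the $i$'th largest of the absolute values of its adjacency eigenvalues (with multiplicity). For an integer $k\ge 1$, $$c_{k}^{\ast}=\sup\{\lambda_{k}^{\ast}(G)/n: G\text{ is a graph of order }n\ge k\}.$$ *)

theory Defs
  imports
    "Graph_Theory.Pair_Digraph"
    "Jordan_Normal_Form.Char_Poly"
    "HOL-Library.Multiset"
    "HOL-Library.Landau_Symbols"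
begin

text \<open>
  The finite simple undirected graphs are the instances of the locale \<^locale>\<open>pair_graph\<close>:
  an edge is a pair of opposite arcs, and there are no loops. Every finite graph is
  isomorphic to one with vertices in \<^typ>\<open>nat\<close>. The rows and columns of the adjacency matrix
  follow the vertices in increasing order; another order would conjugate the
  matrix by a permutation matrix and keep its singular values.
\<close>

definition adjacency_matrix :: "'a :: linorder pair_pre_digraph \<Rightarrow> real mat" where
  "adjacency_matrix G =
     (let vs = sorted_list_of_set (pverts G); n = card (pverts G)
      in mat n n (\<lambda>(i, j). if (vs ! i, vs ! j) \<in> parcs G then 1 else 0))"

text \<open>
  The singular values of \<open>A\<close> are the square roots of the eigenvalues of \<open>A\<^sup>T A\<close>, with
  multiplicity. That matrix is positive semidefinite, so its characteristic polynomial has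
  only nonnegative real roots and the multiset has \<open>dim_col A\<close> elements. For a symmetric \<open>A\<close>,
  these are the absolute values of the eigenvalues of \<open>A\<close>.
\<close>

definition singular_values :: "real mat \<Rightarrow> real multiset" where
  "singular_values A = image_mset sqrt (proots (char_poly (transpose_mat A * A)))"

text \<open>The index starts at 1: \<open>graph_singular_value G 1\<close> is the largest singular value.\<close>

definition graph_singular_value :: "'a :: linorder pair_pre_digraph \<Rightarrow> nat \<Rightarrow> real" where
  "graph_singular_value G i =
     rev (sorted_list_of_multiset (singular_values (adjacency_matrix G))) ! (i - 1)"

text \<open>
  For \<open>k \<ge> 1\<close> the set below is nonempty, and it is bounded above by 1, so the supremum in
  \<^typ>\<open>real\<close> is the true one.
\<close>

definition c_star :: "nat \<Rightarrow> real" where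
  "c_star k = Sup {graph_singular_value G k / real (card (pverts G)) |
                   G :: nat pair_pre_digraph. pair_graph G \<and> card (pverts G) \<ge> k}"

end

theory Submission
  imports Defs "HOL-Number_Theory.Cong"
begin

text \<open>
  Upper bound. Let \<open>A\<close> be the adjacency matrix of a graph of order \<open>n\<close>, let \<open>e\<close> be the sum of
  its entries, and let \<open>\<sigma>\<^sub>1 \<ge> \<sigma>\<^sub>2 \<ge> \<dots>\<close> be its singular values. The squares of the
  singular values sum to the trace of \<open>A\<^sup>2\<close>, which is \<open>e\<close> for a symmetric 0/1 matrix, and the
  Rayleigh quotient at the all-ones vector gives \<open>\<sigma>\<^sub>1 \<ge> e / n\<close>. So
  \<open>(k - 1) \<sigma>\<^sub>k\<^sup>2 \<le> e - (e / n)\<^sup>2 \<le> n\<^sup>2 / 4\<close>. Both facts on \<open>A\<close> come from an orthogonal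
  diagonalisation (\<open>real_spectral_theorem\<close>).

  Lower bound. For every \<open>s \<ge> 1\<close> there is a graph of order \<open>n = s * 2 ^ s\<close> with
  \<open>\<sigma>\<^sub>k / n \<ge> 1 / (2 s)\<close> for all \<open>k \<le> s\<^sup>2 + 1\<close>. Choosing \<open>s = \<lceil>sqrt (k - 1)\<rceil>\<close>, so that
  \<open>s < sqrt (k - 1) + 1\<close>, gives the strict inequality.

  To build the graph, put \<open>N = 2 ^ s\<close> and take \<open>s\<close> sign vectors \<open>h\<^sub>0, \<dots>, h\<^bsub>s-1\<^esub>\<close> of length \<open>N\<close>
  that are orthogonal to each other and to the all-ones vector; the Rademacher functions, which
  read off one binary digit, have this property. Arrange the rank-one blocks
  \<open>h\<^sub>r h\<^sub>r\<^sup>T\<close> along the symmetric Latin square \<open>r = (i + j) mod s\<close>, with a minus sign on the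
  diagonal blocks. This is Kharaghani's device for Hadamard matrices. Two different blocks
  multiply to 0, so the resulting symmetric sign matrix \<open>M\<close> satisfies \<open>M\<^sup>3 = N\<^sup>2 M\<close>, and
  \<open>M 1 = 0\<close>. Its diagonal is \<open>-1\<close>, so \<open>A = (M + J) / 2\<close> (\<open>J\<close> the all-ones matrix) is the
  adjacency matrix of a simple graph. Here \<open>M\<close> and \<open>J\<close> annihilate each other, so the singular
  values of \<open>A\<close> are \<open>0\<close>, \<open>N / 2\<close> and the single value \<open>n / 2\<close> of \<open>J / 2\<close>; the traces
  of \<open>A\<^sup>2\<close> and \<open>A\<^sup>4\<close> show that exactly \<open>s\<^sup>2 + 1\<close> of them are nonzero. All those are
  at least \<open>N / 2 = n / (2 s)\<close>.
\<close>

section \<open>Orthogonal diagonalisation of real symmetric matrices\<close>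

text \<open>
  A complex eigenvalue exists by the fundamental theorem of algebra. It is real because for an
  eigenvector \<open>w\<close> the number \<open>w\<^sup>* A w = z * w\<^sup>* w\<close> is its own conjugate. As a real root of the
  characteristic polynomial, it then has a real eigenvector.
\<close>
lemma symmetric_real_eigenvector:
  fixes A :: "real mat"
  assumes A: "A \<in> carrier_mat n n" and sym: "transpose_mat A = A" and n: "n > 0"
  obtains e v where "v \<in> carrier_vec n" "v \<bullet> v = 1" "A *\<^sub>v v = e \<cdot>\<^sub>v v"
proof -
  let ?C = "map_mat complex_of_real A"
  have C: "?C \<in> carrier_mat n n" using A by simp
  obtain as where as: "char_poly ?C = (\<Prod>a\<leftarrow>as. [:- a, 1:])" "length as = n"
    using char_poly_factorized[OF C] by blast
  have "poly (char_poly ?C) (as ! 0) = 0"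
    using as n by (cases as) auto
  then obtain z where z: "poly (char_poly ?C) z = 0" by blast
  then obtain w where w: "w \<in> carrier_vec n" "w \<noteq> 0\<^sub>v n" "?C *\<^sub>v w = z \<cdot>\<^sub>v w"
    using C unfolding eigenvalue_root_char_poly[OF C, symmetric] eigenvalue_def eigenvector_def
    by auto
  have entry: "(\<Sum>j<n. complex_of_real (A $$ (i, j)) * w $ j) = z * w $ i" if "i < n" for i
  proof -
    have "(?C *\<^sub>v w) $ i = z * w $ i"
      unfolding w(3) using that w(1) by simp
    then show ?thesis
      using that A w(1) by (simp add: scalar_prod_def lessThan_atLeast0)
  qed
  define S where "S = (\<Sum>i<n. cnj (w $ i) * w $ i)"
  define Q where "Q = (\<Sum>i<n. \<Sum>j<n. cnj (w $ i) * (complex_of_real (A $$ (i, j)) * w $ j))"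
  have Q1: "Q = z * S"
    unfolding Q_def S_def sum_distrib_left[symmetric] by (simp add: entry mult.left_commute sum_distrib_left)
  have As: "A $$ (i, j) = A $$ (j, i)" if "i < n" "j < n" for i j
    using that A arg_cong[OF sym, of "\<lambda>X. X $$ (j, i)"] by simp
  have "cnj Q = (\<Sum>i<n. \<Sum>j<n. cnj (w $ j) * (complex_of_real (A $$ (j, i)) * w $ i))"
    unfolding Q_def using As by (simp add: mult_ac)
  also have "\<dots> = Q"
    unfolding Q_def by (rule sum.swap)
  finally have Q2: "cnj Q = Q" .
  have Sr: "S = complex_of_real (\<Sum>i<n. (cmod (w $ i))\<^sup>2)"
    unfolding S_def of_real_sum by (intro sum.cong refl) (metis complex_norm_square mult.commute)
  obtain i where i: "i < n" "w $ i \<noteq> 0"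
    using w(1,2) by (metis carrier_vecD eq_vecI index_zero_vec)
  have "(\<Sum>i<n. (cmod (w $ i))\<^sup>2) > 0"
    using i by (intro sum_pos2[of _ i]) auto
  then have "S \<noteq> 0" "cnj S = S" unfolding Sr by (auto simp del: of_real_sum)
  with Q1 Q2 have "cnj z = z" by auto
  then obtain e where e: "z = complex_of_real e"
    by (metis Reals_cases Reals_cnj_iff)
  have "char_poly ?C = map_poly complex_of_real (char_poly A)"
    by (rule of_real_hom.char_poly_hom[OF A])
  with z e have "poly (char_poly A) e = 0" by simp
  then obtain x where x: "x \<in> carrier_vec n" "x \<noteq> 0\<^sub>v n" "A *\<^sub>v x = e \<cdot>\<^sub>v x"
    using A unfolding eigenvalue_root_char_poly[OF A, symmetric] eigenvalue_def eigenvector_def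
    by auto
  define c where "c = 1 / sqrt (x \<bullet> x)"
  obtain l where l: "l < n" "x $ l \<noteq> 0"
    using x(1,2) by (metis carrier_vecD eq_vecI index_zero_vec)
  have "(\<Sum>i<n. x $ i * x $ i) > 0"
    using l by (intro sum_pos2[of _ l]) (auto simp: zero_less_mult_iff)
  then have "x \<bullet> x > 0"
    using x(1) by (simp add: scalar_prod_def lessThan_atLeast0)
  then have "(c \<cdot>\<^sub>v x) \<bullet> (c \<cdot>\<^sub>v x) = 1"
    using x(1) by (simp add: c_def)
  moreover have "A *\<^sub>v (c \<cdot>\<^sub>v x) = e \<cdot>\<^sub>v (c \<cdot>\<^sub>v x)"
    using x A by (simp add: mult_mat_vec smult_smult_assoc mult.commute)
  ultimately show thesis using that[of "c \<cdot>\<^sub>v x"] x(1) by simp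
qed

text \<open>
  The reflection in the hyperplane orthogonal to \<open>u = e\<^sub>0 - v\<close> exchanges the unit vectors
  \<open>e\<^sub>0\<close> and \<open>v\<close>. It completes \<open>v\<close> to an orthonormal basis by an explicit symmetric matrix.
\<close>
lemma householder_reflection:
  fixes v :: "real vec"
  assumes v: "v \<in> carrier_vec n" and unit: "v \<bullet> v = 1" and n: "n > 0"
  obtains H where "H \<in> carrier_mat n n" "transpose_mat H = H" "H * H = 1\<^sub>m n" "col H 0 = v"
proof (cases "v = unit_vec n 0")
  case True
  show thesis
    by (rule that[of "1\<^sub>m n"]) (use True n in auto)
next
  case False
  define u where "u = (\<lambda>i. (if i = 0 then 1 else 0) - v $ i)"
  \<comment> \<open>this is \<open>2 / (u \<bullet> u)\<close>, since \<open>u \<bullet> u = 2 - 2 * v $ 0\<close> for a unit vector \<open>v\<close>\<close>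
  define c where "c = 1 / (1 - v $ 0)"
  have vv: "(\<Sum>i<n. v $ i * v $ i) = 1"
    using unit v by (simp add: scalar_prod_def lessThan_atLeast0)
  have "(\<Sum>i<n. u i * u i) = (\<Sum>i<n. (if i = 0 then 1 - 2 * v $ 0 else 0) + v $ i * v $ i)"
    by (intro sum.cong) (auto simp: u_def algebra_simps)
  also have "\<dots> = 2 - 2 * v $ 0"
    using n vv by (simp add: sum.distrib sum.delta)
  finally have uu: "(\<Sum>i<n. u i * u i) = 2 - 2 * v $ 0" .
  obtain i where i: "i < n" "u i \<noteq> 0"
    using False v n by (fastforce simp: u_def unit_vec_def intro: eq_vecI)
  have "(\<Sum>i<n. u i * u i) > 0"
    using i by (intro sum_pos2[of _ i]) (auto simp: zero_less_mult_iff)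
  then have cu: "c * (\<Sum>i<n. u i * u i) = 2" and cu0: "c * u 0 = 1"
    unfolding uu c_def by (auto simp: field_simps u_def)
  define H where "H = mat n n (\<lambda>(i, j). (if i = j then 1 else 0) - c * u i * u j)"
  have H: "H \<in> carrier_mat n n" by (simp add: H_def)
  have "(\<Sum>l<n. ((if i = l then 1 else 0) - c * u i * u l) * ((if l = j then 1 else 0) - c * u l * u j))
      = (if i = j then 1 else 0)" if "i < n" "j < n" for i j
  proof -
    have "(\<Sum>l<n. ((if i = l then 1 else 0) - c * u i * u l) * ((if l = j then 1 else 0) - c * u l * u j))
      = (\<Sum>l<n. (if l = i then (if i = j then 1 else 0) - c * u i * u j else 0)
            - (if l = j then c * u i * u j else 0) + c * u i * u j * c * (u l * u l))"
      by (intro sum.cong) (auto simp: algebra_simps)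
    also have "\<dots> = (if i = j then 1 else 0) - 2 * c * u i * u j + c * u i * u j * (c * (\<Sum>l<n. u l * u l))"
      using that by (simp add: sum.distrib sum_subtractf sum.delta sum_distrib_left mult_ac)
    finally show ?thesis unfolding cu by simp
  qed
  then have "H * H = 1\<^sub>m n"
    by (intro eq_matI) (simp_all add: H_def scalar_prod_def lessThan_atLeast0)
  moreover have "transpose_mat H = H"
    by (intro eq_matI) (simp_all add: H_def)
  moreover have "col H 0 = v"
  proof (rule eq_vecI)
    fix i assume "i < dim_vec v"
    then have i: "i < n" using v by simp
    have "col H 0 $ i = (if i = 0 then 1 else 0) - u i * (c * u 0)"
      using i n by (simp add: H_def mult_ac)
    then show "col H 0 $ i = v $ i" unfolding cu0 by (simp add: u_def)
  qed (use v H in simp)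
  ultimately show thesis using H that by blast
qed

text \<open>
  Induction on the dimension: conjugating with a Householder reflection that maps \<open>e\<^sub>0\<close> to a unit
  eigenvector makes the first column, and by symmetry the first row, vanish off the diagonal. The
  remaining block is symmetric of one dimension less.
\<close>
theorem real_spectral_theorem:
  fixes A :: "real mat"
  assumes "A \<in> carrier_mat n n" and "transpose_mat A = A"
  shows "\<exists>B U. similar_mat_wit A B U (transpose_mat U) \<and> diagonal_mat B"
  using assms
proof (induction n arbitrary: A)
  case 0
  then have "similar_mat_wit A A (1\<^sub>m 0) (transpose_mat (1\<^sub>m 0))"
    using similar_mat_wit_refl[of A 0] by simp
  then show ?case using 0 unfolding diagonal_mat_def by (metis carrier_matD(1) less_nat_zero_code)
next
  case (Suc m)
  note A = Suc.prems(1)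
  obtain e v where v: "v \<in> carrier_vec (Suc m)" "v \<bullet> v = 1" "A *\<^sub>v v = e \<cdot>\<^sub>v v"
    by (rule symmetric_real_eigenvector[OF Suc.prems zero_less_Suc])
  obtain H where H: "H \<in> carrier_mat (Suc m) (Suc m)" "transpose_mat H = H" "H * H = 1\<^sub>m (Suc m)"
      "col H 0 = v"
    by (rule householder_reflection[OF v(1,2) zero_less_Suc])
  define A' where "A' = H * A * H"
  have A': "A' \<in> carrier_mat (Suc m) (Suc m)" using A H by (simp add: A'_def)
  have wit: "similar_mat_wit A A' H H"
  proof (rule similar_mat_witI[OF H(3) H(3)])
    have "H * A' * H = (H * H) * A * (H * H)"
      using A H(1) by (simp add: A'_def assoc_mult_mat[of _ "Suc m" "Suc m" _ "Suc m" _ "Suc m"])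
    then show "A = H * A' * H" using A H by simp
  qed (use A A' H in auto)
  have A't: "transpose_mat A' = A'"
  proof -
    have "transpose_mat A' = transpose_mat H * (transpose_mat A * transpose_mat H)"
      using A H(1) unfolding A'_def by (metis mult_carrier_mat transpose_mult)
    also have "\<dots> = A'"
      unfolding A'_def H(2) Suc.prems(2) using A H(1) by (metis assoc_mult_mat)
    finally show ?thesis .
  qed
  have "col A' 0 = H *\<^sub>v (A *\<^sub>v col H 0)"
    unfolding A'_def assoc_mult_mat[OF H(1) A H(1)] 
      col_mult2[OF H(1) mult_carrier_mat[OF A H(1)] zero_less_Suc] col_mult2[OF A H(1) zero_less_Suc] ..
  also have "\<dots> = e \<cdot>\<^sub>v (H *\<^sub>v col H 0)"
    unfolding H(4) v(3) using H(1) v(1) by (simp add: mult_mat_vec)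
  also have "H *\<^sub>v col H 0 = col (H * H) 0"
    by (rule col_mult2[OF H(1) H(1) zero_less_Suc, symmetric])
  finally have col: "col A' 0 = e \<cdot>\<^sub>v unit_vec (Suc m) 0"
    unfolding H(3) by simp
  have c0: "A' $$ (i, 0) = (if i = 0 then e else 0)" if "i < Suc m" for i
    using arg_cong[OF col, of "\<lambda>x. x $ i"] that A' by simp
  have sym': "A' $$ (i, j) = A' $$ (j, i)" if "i < Suc m" "j < Suc m" for i j
    using that A' arg_cong[OF A't, of "\<lambda>X. X $$ (j, i)"] by simp
  define E where "E = mat 1 1 (\<lambda>_. e)"
  define D where "D = mat m m (\<lambda>(i, j). A' $$ (Suc i, Suc j))"
  have block: "A' = four_block_mat E (0\<^sub>m 1 m) (0\<^sub>m m 1) D"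
  proof (rule eq_matI)
    fix i j assume ij: "i < dim_row (four_block_mat E (0\<^sub>m 1 m) (0\<^sub>m m 1) D)"
      "j < dim_col (four_block_mat E (0\<^sub>m 1 m) (0\<^sub>m m 1) D)"
    then show "A' $$ (i, j) = four_block_mat E (0\<^sub>m 1 m) (0\<^sub>m m 1) D $$ (i, j)"
      using c0[of i] c0[of j] sym'[of 0 j]
      by (cases i; cases j) (auto simp: E_def D_def)
  qed (use A' in \<open>auto simp: E_def D_def\<close>)
  have D: "D \<in> carrier_mat m m" "transpose_mat D = D"
    by (auto simp: D_def intro!: eq_matI sym')
  obtain B U where BU: "similar_mat_wit D B U (transpose_mat U)" "diagonal_mat B"
    using Suc.IH[OF D] by blast
  note BUc = similar_mat_witD2[OF D(1) BU(1)]
  have E: "E \<in> carrier_mat 1 1" by (simp add: E_def)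
  let ?V = "four_block_mat (1\<^sub>m 1) (0\<^sub>m 1 m) (0\<^sub>m m 1) U"
  let ?V' = "four_block_mat (1\<^sub>m 1) (0\<^sub>m 1 m) (0\<^sub>m m 1) (transpose_mat U)"
  let ?B = "four_block_mat E (0\<^sub>m 1 m) (0\<^sub>m m 1) B"
  have Vt: "?V' = transpose_mat ?V"
    using BUc by (subst transpose_four_block_mat[of _ 1 1 _ m _ m]) auto
  have z: "0\<^sub>m 1 m = 1\<^sub>m 1 * 0\<^sub>m 1 m * transpose_mat U" "0\<^sub>m m 1 = U * 0\<^sub>m m 1 * 1\<^sub>m 1"
    using BUc by auto
  have "similar_mat_wit A' ?B ?V ?V'"
    unfolding block
    by (rule similar_mat_wit_four_block[OF similar_mat_wit_refl[OF E] BU(1) z E D(1)]) auto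
  from similar_mat_wit_trans[OF wit this]
  have "similar_mat_wit A ?B (H * ?V) (?V' * H)" .
  also have "?V' * H = transpose_mat (H * ?V)"
    unfolding Vt using H BUc by (subst transpose_mult[of _ "Suc m" "Suc m" _ "Suc m"]) auto
  finally have "similar_mat_wit A ?B (H * ?V) (transpose_mat (H * ?V))" .
  moreover have "diagonal_mat ?B"
    using BU(2) BUc unfolding diagonal_mat_def by (auto simp: E_def)
  ultimately show ?case by blast
qed

lemma mult_mat_entry:
  assumes "X \<in> carrier_mat a b" "Y \<in> carrier_mat b c" "i < a" "j < c"
  shows "(X * Y) $$ (i, j) = (\<Sum>k<b. X $$ (i, k) * Y $$ (k, j))"
  using assms by (simp add: scalar_prod_def lessThan_atLeast0)

text \<open>
  Invariance of the trace under similarity, with the trace written as a plain sum.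
\<close>
lemma diag_mat_sum_similar:
  fixes X :: "'a :: comm_semiring_1 mat"
  assumes X: "X \<in> carrier_mat n n" and wit: "similar_mat_wit X Y P Q"
  shows "(\<Sum>i<n. X $$ (i, i)) = (\<Sum>i<n. Y $$ (i, i))"
proof -
  note w = similar_mat_witD2[OF X wit]
  have "(\<Sum>i<n. X $$ (i, i)) = (\<Sum>i<n. \<Sum>j<n. (P * Y) $$ (i, j) * Q $$ (j, i))"
    unfolding w(3) by (intro sum.cong refl) (simp add: mult_mat_entry[OF mult_carrier_mat[OF w(6,5)] w(7)])
  also have "\<dots> = (\<Sum>j<n. \<Sum>i<n. Q $$ (j, i) * (P * Y) $$ (i, j))"
    by (subst sum.swap) (simp add: mult.commute)
  also have "\<dots> = (\<Sum>j<n. (Q * (P * Y)) $$ (j, j))"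
    by (intro sum.cong refl) (simp add: mult_mat_entry[OF w(7) mult_carrier_mat[OF w(6,5)]])
  also have "Q * (P * Y) = Y"
    using w(5) by (simp add: w(2) flip: assoc_mult_mat[OF w(7,6,5)])
  finally show ?thesis .
qed

lemma diagonal_mat_mult_entry:
  fixes B C :: "'a :: semiring_0 mat"
  assumes "B \<in> carrier_mat n n" "C \<in> carrier_mat n n" "diagonal_mat C" "i < n" "j < n"
  shows "(B * C) $$ (i, j) = B $$ (i, j) * C $$ (j, j)"
proof -
  have "(B * C) $$ (i, j) = (\<Sum>k<n. if k = j then B $$ (i, j) * C $$ (j, j) else 0)"
    unfolding mult_mat_entry[OF assms(1,2,4,5)]
    using assms by (intro sum.cong) (auto simp: diagonal_mat_def)
  then show ?thesis using assms by simp
qed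

lemma diagonal_mat_pow:
  fixes B :: "'a :: comm_semiring_1 mat"
  assumes B: "B \<in> carrier_mat n n" "diagonal_mat B"
  shows "diagonal_mat (B ^\<^sub>m k)" and "i < n \<Longrightarrow> (B ^\<^sub>m k) $$ (i, i) = (B $$ (i, i)) ^ k"
proof -
  have "diagonal_mat (B ^\<^sub>m k) \<and> (\<forall>i<n. (B ^\<^sub>m k) $$ (i, i) = (B $$ (i, i)) ^ k)"
  proof (induction k)
    case 0
    then show ?case using B by (auto simp: diagonal_mat_def)
  next
    case (Suc k)
    have "B ^\<^sub>m k \<in> carrier_mat n n" using B by simp
    note e = diagonal_mat_mult_entry[OF this B]
    then show ?case using Suc B by (auto simp: diagonal_mat_def mult.commute)
  qed
  then show "diagonal_mat (B ^\<^sub>m k)" "i < n \<Longrightarrow> (B ^\<^sub>m k) $$ (i, i) = (B $$ (i, i)) ^ k"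
    by auto
qed


section \<open>Singular values of symmetric matrices\<close>

text \<open>
  \<open>A\<^sup>T A = A\<^sup>2\<close> is similar to the diagonal matrix \<open>B\<^sup>2\<close>, so the roots of its
  characteristic polynomial are the squares of the eigenvalues of \<open>A\<close>.
\<close>
lemma singular_values_symmetric:
  assumes A: "A \<in> carrier_mat n n" and sym: "transpose_mat A = A"
    and wit: "similar_mat_wit A B U V" and diag: "diagonal_mat B"
  shows "singular_values A = mset (map abs (diag_mat B))"
proof -
  note w = similar_mat_witD2[OF A wit]
  have B: "B \<in> carrier_mat n n" using w by simp
  have "similar_mat_wit (A ^\<^sub>m 2) (B ^\<^sub>m 2) U V"
    by (rule similar_mat_wit_pow[OF wit])
  moreover have "A ^\<^sub>m 2 = transpose_mat A * A"
    using A by (simp add: numeral_2_eq_2 sym)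
  ultimately have "char_poly (transpose_mat A * A) = char_poly (B ^\<^sub>m 2)"
    by (metis char_poly_similar similar_mat_def)
  also have "\<dots> = (\<Prod>a\<leftarrow>diag_mat (B ^\<^sub>m 2). [:- a, 1:])"
    using diagonal_mat_pow(1)[OF B diag, of 2] B
    by (intro char_poly_upper_triangular[of _ n]) (auto simp: diagonal_mat_def upper_triangular_def)
  also have "diag_mat (B ^\<^sub>m 2) = map (\<lambda>b. b\<^sup>2) (diag_mat B)"
    using diagonal_mat_pow(2)[OF B diag, of _ 2] B by (simp add: diag_mat_def)
  finally have cp: "char_poly (transpose_mat A * A) = (\<Prod>b\<leftarrow>diag_mat B. [:- b\<^sup>2, 1:])"
    by (simp add: o_def)
  have "proots (\<Prod>b\<leftarrow>bs. [:- b\<^sup>2, 1:]) = mset (map (\<lambda>b. b\<^sup>2) bs)" for bs :: "real list"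
  proof (induction bs)
    case (Cons b bs)
    have "(\<Prod>b\<leftarrow>bs. [:- b\<^sup>2, 1:]) \<noteq> 0"
      by (auto simp: prod_list_zero_iff)
    then show ?case using Cons by (simp add: proots_mult del: mult_pCons_left)
  qed simp
  then show ?thesis
    unfolding singular_values_def cp by (simp add: multiset.map_comp o_def)
qed

text \<open>
  In the coordinates \<open>y = U\<^sup>T x\<close> the form is \<open>\<Sum>k. B\<^sub>k\<^sub>k * y\<^sub>k\<^sup>2\<close>, and \<open>y\<close> has the same
  length as \<open>x\<close>.
\<close>
lemma quadratic_form_le:
  fixes A :: "real mat" and x :: "nat \<Rightarrow> real"
  assumes A: "A \<in> carrier_mat n n" and wit: "similar_mat_wit A B U (transpose_mat U)"
    and diag: "diagonal_mat B" and c: "\<And>i. i < n \<Longrightarrow> B $$ (i, i) \<le> c"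
  shows "(\<Sum>i<n. \<Sum>j<n. x i * A $$ (i, j) * x j) \<le> c * (\<Sum>i<n. (x i)\<^sup>2)"
proof -
  note w = similar_mat_witD2[OF A wit]
  define y where "y k = (\<Sum>i<n. U $$ (i, k) * x i)" for k
  \<comment> \<open>used twice: with the eigenvalues as weights for \<open>A\<close>, with weights 1 for the identity matrix\<close>
  have expand: "(\<Sum>i<n. \<Sum>j<n. x i * (\<Sum>k<n. d k * (U $$ (i, k) * U $$ (j, k))) * x j)
      = (\<Sum>k<n. d k * (y k)\<^sup>2)" for d
  proof -
    have "(\<Sum>i<n. \<Sum>j<n. x i * (\<Sum>k<n. d k * (U $$ (i, k) * U $$ (j, k))) * x j)
      = (\<Sum>i<n. \<Sum>j<n. \<Sum>k<n. d k * ((U $$ (i, k) * x i) * (U $$ (j, k) * x j)))"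
      by (simp add: sum_distrib_left sum_distrib_right mult_ac)
    also have "\<dots> = (\<Sum>i<n. \<Sum>k<n. \<Sum>j<n. d k * ((U $$ (i, k) * x i) * (U $$ (j, k) * x j)))"
      by (intro sum.cong refl sum.swap)
    also have "\<dots> = (\<Sum>k<n. \<Sum>i<n. \<Sum>j<n. d k * ((U $$ (i, k) * x i) * (U $$ (j, k) * x j)))"
      by (rule sum.swap)
    also have "\<dots> = (\<Sum>k<n. d k * (y k)\<^sup>2)"
      unfolding y_def power2_eq_square sum_product by (simp add: sum_distrib_left)
    finally show ?thesis .
  qed
  have Ae: "A $$ (i, j) = (\<Sum>k<n. B $$ (k, k) * (U $$ (i, k) * U $$ (j, k)))" if "i < n" "j < n" for i j
  proof -
    have "A $$ (i, j) = (\<Sum>k<n. (U * B) $$ (i, k) * U $$ (j, k))"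
      using that w(6) mult_mat_entry[OF mult_carrier_mat[OF w(6,5)] w(7)] by (subst w(3)) simp
    also have "\<dots> = (\<Sum>k<n. B $$ (k, k) * (U $$ (i, k) * U $$ (j, k)))"
      using diagonal_mat_mult_entry[OF w(6) w(5) diag that(1)] by (simp add: mult_ac)
    finally show ?thesis .
  qed
  have Ie: "(if i = j then 1 else 0) = (\<Sum>k<n. 1 * (U $$ (i, k) * U $$ (j, k)))" if "i < n" "j < n" for i j
  proof -
    have "(\<Sum>k<n. 1 * (U $$ (i, k) * U $$ (j, k))) = (U * transpose_mat U) $$ (i, j)"
      unfolding mult_mat_entry[OF w(6,7) that] using w(6) that by (intro sum.cong) auto
    then show ?thesis unfolding w(1) using that by simp
  qed
  have "(\<Sum>i<n. \<Sum>j<n. x i * A $$ (i, j) * x j) = (\<Sum>k<n. B $$ (k, k) * (y k)\<^sup>2)"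
    unfolding expand[symmetric] by (simp add: Ae)
  also have "\<dots> \<le> (\<Sum>k<n. c * (y k)\<^sup>2)"
    by (intro sum_mono mult_right_mono) (auto simp: c)
  also have "\<dots> = c * (\<Sum>k<n. 1 * (y k)\<^sup>2)"
    by (simp add: sum_distrib_left)
  also have "(\<Sum>k<n. 1 * (y k)\<^sup>2) = (\<Sum>i<n. \<Sum>j<n. x i * (if i = j then 1 else 0) * x j)"
    unfolding expand[symmetric] by (intro sum.cong refl) (simp only: Ie lessThan_iff)
  also have "\<dots> = (\<Sum>i<n. \<Sum>j<n. if j = i then (x i)\<^sup>2 else 0)"
    by (intro sum.cong refl) (auto simp: power2_eq_square)
  also have "\<dots> = (\<Sum>i<n. (x i)\<^sup>2)" by simp
  finally show ?thesis .
qed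

text \<open>
  The index starts at 1.
\<close>
definition nth_largest :: "'a :: linorder multiset \<Rightarrow> nat \<Rightarrow> 'a" where
  "nth_largest M k = rev (sorted_list_of_multiset M) ! (k - 1)"

text \<open>
  This turns a count of large singular values into a bound on the one with index \<open>k\<close>.
\<close>
lemma nth_largest_ge:
  assumes k: "0 < k" "k \<le> size (filter_mset (\<lambda>x. c \<le> x) M)"
  shows "c \<le> nth_largest M k"
proof (rule ccontr)
  let ?xs = "rev (sorted_list_of_multiset M)"
  have sorted: "sorted (rev ?xs)" by simp
  have len: "size (filter_mset (\<lambda>x. c \<le> x) M) = length (filter (\<lambda>x. c \<le> x) ?xs)"
    by (metis mset_filter mset_rev mset_sorted_list_of_multiset size_mset)
  assume less: "\<not> c \<le> nth_largest M k"
  have "filter (\<lambda>x. c \<le> x) (drop (k - 1) ?xs) = []"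
  proof -
    have "x < c" if "x \<in> set (drop (k - 1) ?xs)" for x
    proof -
      obtain j where j: "j < length ?xs - (k - 1)" "x = ?xs ! (k - 1 + j)"
        using \<open>x \<in> _\<close> by (auto simp: in_set_conv_nth)
      then have "x \<le> ?xs ! (k - 1)"
        using sorted_rev_nth_mono[OF sorted, of "k - 1" "k - 1 + j"] by simp
      then show ?thesis using less by (simp add: nth_largest_def)
    qed
    then show ?thesis by (auto simp: filter_empty_conv not_le)
  qed
  then have "length (filter (\<lambda>x. c \<le> x) ?xs) = length (filter (\<lambda>x. c \<le> x) (take (k - 1) ?xs))"
    by (metis append_Nil2 append_take_drop_id filter_append)
  also have "\<dots> \<le> k - 1"
    using length_filter_le[of _ "take (k - 1) ?xs"] by (metis length_take min.bounded_iff)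
  finally show False using k len by simp
qed

text \<open>
  The entries with indices \<open>2, \<dots>, k\<close> are all at least the one with index \<open>k\<close>.
\<close>
lemma sum_squares_ge_nth_largest:
  fixes M :: "real multiset"
  assumes k: "0 < k" "k \<le> size M" and nonneg: "\<And>x. x \<in># M \<Longrightarrow> 0 \<le> x"
  shows "(nth_largest M 1)\<^sup>2 + (real k - 1) * (nth_largest M k)\<^sup>2 \<le> (\<Sum>x\<in>#M. x\<^sup>2)"
proof -
  let ?xs = "rev (sorted_list_of_multiset M)"
  have sorted: "sorted (rev ?xs)" by simp
  have len: "length ?xs = size M"
    by (metis length_rev mset_sorted_list_of_multiset size_mset)
  have pos: "0 \<le> ?xs ! j" if "j < size M" for j
    using that nonneg nth_mem[of j ?xs] len by (metis mset_rev mset_sorted_list_of_multiset set_mset_mset)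
  have "(\<Sum>x\<in>#M. x\<^sup>2) = sum_list (map (\<lambda>x. x\<^sup>2) ?xs)"
    by (metis mset_rev mset_map mset_sorted_list_of_multiset sum_mset_sum_list)
  also have "\<dots> = (\<Sum>j<size M. (?xs ! j)\<^sup>2)"
    using len by (simp add: sum_list_sum_nth lessThan_atLeast0)
  also have "\<dots> \<ge> (\<Sum>j<k. (?xs ! j)\<^sup>2)"
    using k by (intro sum_mono2) auto
  moreover have "(\<Sum>j<k. (?xs ! j)\<^sup>2) = (?xs ! 0)\<^sup>2 + (\<Sum>j\<in>{1..<k}. (?xs ! j)\<^sup>2)"
    using k(1) by (simp add: lessThan_atLeast0 sum.atLeast_Suc_lessThan)
  moreover have "(\<Sum>j\<in>{1..<k}. (?xs ! j)\<^sup>2) \<ge> (\<Sum>j\<in>{1..<k}. (?xs ! (k - 1))\<^sup>2)"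
    using k len pos[of "k - 1"] sorted_rev_nth_mono[OF sorted]
    by (intro sum_mono power_mono) auto
  ultimately show ?thesis using k(1)
    by (simp add: nth_largest_def of_nat_diff)
qed

lemma nth_largest_1_ge:
  assumes "x \<in># M" shows "x \<le> nth_largest M 1"
proof (rule nth_largest_ge)
  have "filter_mset ((\<le>) x) M \<noteq> {#}"
    using assms by (metis dual_order.refl empty_iff mem_Collect_eq set_mset_empty set_mset_filter)
  then show "1 \<le> size (filter_mset ((\<le>) x) M)"
    unfolding nonempty_has_size by linarith
qed simp

section \<open>The upper bound\<close>

lemma graph_singular_value_eq_nth_largest:
  "graph_singular_value G k = nth_largest (singular_values (adjacency_matrix G)) k"
  by (simp add: graph_singular_value_def nth_largest_def)

lemma adjacency_matrix_facts:
  fixes G :: "'a :: linorder pair_pre_digraph"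
  assumes "pair_graph G"
  defines "n \<equiv> card (pverts G)" and "A \<equiv> adjacency_matrix G"
  shows "A \<in> carrier_mat n n" "transpose_mat A = A"
    "\<And>i j. i < n \<Longrightarrow> j < n \<Longrightarrow> A $$ (i, j) \<in> {0, 1}"
proof -
  interpret pair_graph G by fact
  have sym: "(u, v) \<in> parcs G \<longleftrightarrow> (v, u) \<in> parcs G" for u v
    using pair_sym_arcs by (auto simp: symmetric_def dest: symD)
  show "A \<in> carrier_mat n n" "transpose_mat A = A"
    "\<And>i j. i < n \<Longrightarrow> j < n \<Longrightarrow> A $$ (i, j) \<in> {0, 1}"
    unfolding A_def adjacency_matrix_def Let_def n_def
    by (auto intro!: eq_matI simp: sym)
qed

text \<open>
  With \<open>e\<close> the sum of all entries, the trace of \<open>A\<^sup>2\<close> is \<open>e\<close>, so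
  \<open>\<sigma>\<^sub>1\<^sup>2 + (k - 1) \<sigma>\<^sub>k\<^sup>2 \<le> e\<close>, while \<open>\<sigma>\<^sub>1 \<ge> e / n\<close>. The worst case of
  \<open>e - (e / n)\<^sup>2\<close> is \<open>e = n\<^sup>2 / 2\<close>.
\<close>
lemma singular_value_01_matrix_le:
  fixes A :: "real mat"
  assumes A: "A \<in> carrier_mat n n" and sym: "transpose_mat A = A"
    and entries: "\<And>i j. i < n \<Longrightarrow> j < n \<Longrightarrow> A $$ (i, j) \<in> {0, 1}"
    and k: "2 \<le> k" "k \<le> n"
  shows "nth_largest (singular_values A) k \<le> real n / (2 * sqrt (real k - 1))"
proof -
  obtain B U where wit: "similar_mat_wit A B U (transpose_mat U)" and diag: "diagonal_mat B"
    using real_spectral_theorem[OF A sym] by blast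
  have B: "B \<in> carrier_mat n n" using similar_mat_witD2[OF A wit] by simp
  let ?M = "singular_values A"
  have M: "?M = mset (map abs (diag_mat B))"
    by (rule singular_values_symmetric[OF A sym wit diag])
  define e where "e = (\<Sum>i<n. \<Sum>j<n. A $$ (i, j))"
  have "e = (\<Sum>i<n. (A ^\<^sub>m 2) $$ (i, i))"
  proof -
    have "(A ^\<^sub>m 2) $$ (i, i) = (\<Sum>j<n. A $$ (i, j))" if "i < n" for i
    proof -
      have "(A ^\<^sub>m 2) $$ (i, i) = (\<Sum>j<n. A $$ (i, j) * A $$ (j, i))"
        using A mult_mat_entry[OF A A that that] by (simp add: numeral_2_eq_2)
      also have "\<dots> = (\<Sum>j<n. A $$ (i, j))"
      proof (intro sum.cong refl)
        fix j assume "j \<in> {..<n}"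
        then show "A $$ (i, j) * A $$ (j, i) = A $$ (i, j)"
          using entries[of i j] that A arg_cong[OF sym, of "\<lambda>X. X $$ (i, j)"] by auto
      qed
      finally show ?thesis .
    qed
    then show ?thesis by (simp add: e_def)
  qed
  also have "\<dots> = (\<Sum>i<n. (B ^\<^sub>m 2) $$ (i, i))"
    using A by (intro diag_mat_sum_similar[OF _ similar_mat_wit_pow[OF wit]]) simp
  also have "\<dots> = (\<Sum>i<n. (B $$ (i, i))\<^sup>2)"
    using diagonal_mat_pow(2)[OF B diag] by simp
  also have "\<dots> = (\<Sum>x\<in>#?M. x\<^sup>2)"
    using B by (simp add: M diag_mat_def lessThan_atLeast0 o_def sum_mset_sum_list
        interv_sum_list_conv_sum_set_nat flip: mset_map)
  finally have e_sq: "e = (\<Sum>x\<in>#?M. x\<^sup>2)" .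
  have size: "size ?M = n" unfolding M using B by (simp add: diag_mat_def)
  let ?t = "nth_largest ?M 1" and ?x = "nth_largest ?M k"
  have "(\<Sum>i<n. \<Sum>j<n. 1 * A $$ (i, j) * 1) \<le> ?t * (\<Sum>i<n. 1\<^sup>2)"
  proof (rule quadratic_form_le[OF A wit diag])
    fix i assume "i < n"
    then have "\<bar>B $$ (i, i)\<bar> \<in># ?M" using B by (auto simp: M diag_mat_def)
    then show "B $$ (i, i) \<le> ?t" using nth_largest_1_ge[of "\<bar>B $$ (i, i)\<bar>" ?M] by linarith
  qed
  then have top: "e \<le> ?t * n" by (simp add: e_def)
  have "0 \<le> e" unfolding e_def using entries by (intro sum_nonneg) force
  have "?t\<^sup>2 + (real k - 1) * ?x\<^sup>2 \<le> e"
    unfolding e_sq using k size by (intro sum_squares_ge_nth_largest) (auto simp: M)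
  moreover have "(e / n)\<^sup>2 \<le> ?t\<^sup>2"
    using top k \<open>0 \<le> e\<close> by (intro power_mono) (auto simp: field_simps)
  moreover have "e - (e / n)\<^sup>2 \<le> (n / 2)\<^sup>2"
  proof -
    have "(n / 2)\<^sup>2 - (e - (e / n)\<^sup>2) = (n / 2 - e / n)\<^sup>2"
      using k by (simp add: power2_diff)
    then show ?thesis by (metis diff_ge_0_iff_ge zero_le_power2)
  qed
  ultimately have "(sqrt (real k - 1) * ?x)\<^sup>2 \<le> (n / 2)\<^sup>2"
    using k by (simp add: power_mult_distrib)
  then have "sqrt (real k - 1) * ?x \<le> n / 2" by (rule power2_le_imp_le) simp
  then show ?thesis using k by (simp add: field_simps)
qed

lemma graph_singular_value_ratio_le:
  assumes G: "pair_graph G" and k: "2 \<le> k" "k \<le> card (pverts G)"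
  shows "graph_singular_value G k / real (card (pverts G)) \<le> 1 / (2 * sqrt (real k - 1))"
proof -
  let ?n = "real (card (pverts G))" and ?c = "2 * sqrt (real k - 1)"
  have "graph_singular_value G k \<le> ?n / ?c"
    unfolding graph_singular_value_eq_nth_largest
    by (rule singular_value_01_matrix_le[OF _ _ _ k]) (fact adjacency_matrix_facts[OF G])+
  then have "graph_singular_value G k / ?n \<le> ?n / ?c / ?n" by (rule divide_right_mono) simp
  also have "\<dots> = 1 / ?c" using k by simp
  finally show ?thesis .
qed

section \<open>The spectrum of a 0/1 matrix coming from a sign matrix\<close>

lemma sum_pow_mat_diag:
  fixes A :: "real mat"
  assumes A: "A \<in> carrier_mat n n" and wit: "similar_mat_wit A B U V" and diag: "diagonal_mat B"
  shows "(\<Sum>i<n. (A ^\<^sub>m k) $$ (i, i)) = (\<Sum>i<n. (B $$ (i, i)) ^ k)"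
proof -
  have B: "B \<in> carrier_mat n n" using similar_mat_witD2[OF A wit] by simp
  have "(\<Sum>i<n. (A ^\<^sub>m k) $$ (i, i)) = (\<Sum>i<n. (B ^\<^sub>m k) $$ (i, i))"
    using A by (intro diag_mat_sum_similar[OF _ similar_mat_wit_pow[OF wit]]) simp
  then show ?thesis using diagonal_mat_pow(2)[OF B diag] by simp
qed

text \<open>
  A polynomial that annihilates \<open>A\<close> annihilates every eigenvalue: conjugation turns \<open>A ^ k\<close> into
  \<open>B ^ k\<close>, and each diagonal entry of \<open>V * X * U\<close> is linear in \<open>X\<close>.
\<close>
lemma diagonal_root_of_annihilator:
  fixes A :: "real mat"
  assumes A: "A \<in> carrier_mat n n" and wit: "similar_mat_wit A B U V" and diag: "diagonal_mat B"
    and annihil: "\<And>i j. i < n \<Longrightarrow> j < n \<Longrightarrow> (\<Sum>k\<in>K. c k * (A ^\<^sub>m k) $$ (i, j)) = 0"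
    and l: "l < n"
  shows "(\<Sum>k\<in>K. c k * (B $$ (l, l)) ^ k) = 0"
proof -
  note w = similar_mat_witD2[OF A wit]
  have B: "B \<in> carrier_mat n n" using w by simp
  have entry: "(B $$ (l, l)) ^ k = (\<Sum>i<n. \<Sum>j<n. V $$ (l, i) * U $$ (j, l) * (A ^\<^sub>m k) $$ (i, j))" for k
  proof -
    have Ak: "A ^\<^sub>m k \<in> carrier_mat n n" using A by simp
    note wk = similar_mat_wit_sym[OF similar_mat_wit_pow[OF wit, of k]]
    have "B ^\<^sub>m k \<in> carrier_mat n n" using B by simp
    note wk = similar_mat_witD2[OF this wk]
    have "(B $$ (l, l)) ^ k = (V * A ^\<^sub>m k * U) $$ (l, l)"
      using diagonal_mat_pow(2)[OF B diag l, of k] wk(3) by simp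
    also have "\<dots> = (\<Sum>j<n. (\<Sum>i<n. V $$ (l, i) * (A ^\<^sub>m k) $$ (i, j)) * U $$ (j, l))"
      using l by (simp add: mult_mat_entry[OF mult_carrier_mat[OF w(7) Ak] w(6) l l]
          mult_mat_entry[OF w(7) Ak l])
    also have "\<dots> = (\<Sum>j<n. \<Sum>i<n. V $$ (l, i) * U $$ (j, l) * (A ^\<^sub>m k) $$ (i, j))"
      by (simp add: sum_distrib_left sum_distrib_right mult_ac)
    also have "\<dots> = (\<Sum>i<n. \<Sum>j<n. V $$ (l, i) * U $$ (j, l) * (A ^\<^sub>m k) $$ (i, j))"
      by (rule sum.swap)
    finally show ?thesis .
  qed
  have "(\<Sum>k\<in>K. c k * (B $$ (l, l)) ^ k)
      = (\<Sum>k\<in>K. \<Sum>i<n. \<Sum>j<n. V $$ (l, i) * U $$ (j, l) * (c k * (A ^\<^sub>m k) $$ (i, j)))"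
    unfolding entry by (simp add: sum_distrib_left mult_ac)
  also have "\<dots> = (\<Sum>i<n. \<Sum>k\<in>K. \<Sum>j<n. V $$ (l, i) * U $$ (j, l) * (c k * (A ^\<^sub>m k) $$ (i, j)))"
    by (rule sum.swap)
  also have "\<dots> = (\<Sum>i<n. \<Sum>j<n. \<Sum>k\<in>K. V $$ (l, i) * U $$ (j, l) * (c k * (A ^\<^sub>m k) $$ (i, j)))"
    by (intro sum.cong refl sum.swap)
  also have "\<dots> = (\<Sum>i<n. \<Sum>j<n. V $$ (l, i) * U $$ (j, l) * (\<Sum>k\<in>K. c k * (A ^\<^sub>m k) $$ (i, j)))"
    by (simp add: sum_distrib_left)
  also have "\<dots> = 0" using annihil by simp
  finally show ?thesis .
qed

text \<open>
  A symmetric sign matrix \<open>M\<close> of order \<open>n\<close> with \<open>M 1 = 0\<close> and \<open>M\<^sup>3 = N\<^sup>2 M\<close>. Its nonzero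
  eigenvalues are \<open>\<plusminus>N\<close>, so its rank is \<open>(n / N)\<^sup>2\<close> by the trace of \<open>M\<^sup>2\<close>.
\<close>
locale sign_matrix =
  fixes m :: "nat \<Rightarrow> nat \<Rightarrow> real" and n :: nat and N :: real
  assumes N: "0 < N" "N \<le> real n"
    and sym: "m v w = m w v"
    and sign: "v < n \<Longrightarrow> w < n \<Longrightarrow> m v w = 1 \<or> m v w = -1"
    and row_sum: "v < n \<Longrightarrow> (\<Sum>w<n. m v w) = 0"
    and cube: "v < n \<Longrightarrow> w < n \<Longrightarrow> (\<Sum>u<n. (\<Sum>t<n. m v t * m t u) * m u w) = N\<^sup>2 * m v w"
begin

definition zero_one_mat :: "real mat" where
  "zero_one_mat = mat n n (\<lambda>(v, w). (m v w + 1) / 2)"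

definition m2 :: "nat \<Rightarrow> nat \<Rightarrow> real" where
  "m2 v w = (\<Sum>u<n. m v u * m u w)"

lemma zero_one_mat_carrier: "zero_one_mat \<in> carrier_mat n n"
  and zero_one_mat_sym: "transpose_mat zero_one_mat = zero_one_mat"
  using sym by (auto simp: zero_one_mat_def intro!: eq_matI)

lemma zero_one_mat_entry: "v < n \<Longrightarrow> w < n \<Longrightarrow> zero_one_mat $$ (v, w) = (m v w + 1) / 2"
  by (simp add: zero_one_mat_def)

lemma col_sum: "w < n \<Longrightarrow> (\<Sum>v<n. m v w) = 0"
  using row_sum[of w] by (simp add: sym[of _ w])

lemma m2_row_sum: "(\<Sum>w<n. m2 v w) = 0"
  unfolding m2_def by (subst sum.swap) (simp add: row_sum flip: sum_distrib_left)

lemma m2_m: "v < n \<Longrightarrow> w < n \<Longrightarrow> (\<Sum>u<n. m2 v u * m u w) = N\<^sup>2 * m v w"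
  unfolding m2_def by (rule cube)

text \<open>
  Products of \<open>M\<close> with the all-ones matrix \<open>J\<close> vanish, so the powers of \<open>(M + J) / 2\<close> are
  combinations of a power of \<open>M\<close> and \<open>J\<close>. Those of \<open>M\<close> reduce by \<open>M\<^sup>3 = N\<^sup>2 M\<close>.
\<close>
lemma pow2: "v < n \<Longrightarrow> w < n \<Longrightarrow> (zero_one_mat ^\<^sub>m 2) $$ (v, w) = (m2 v w + real n) / 4"
proof -
  assume vw: "v < n" "w < n"
  have "(zero_one_mat ^\<^sub>m 2) $$ (v, w) = (\<Sum>u<n. ((m v u + 1) / 2) * ((m u w + 1) / 2))"
    using vw mult_mat_entry[OF zero_one_mat_carrier zero_one_mat_carrier vw] zero_one_mat_carrier
    by (simp add: numeral_2_eq_2 zero_one_mat_entry)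
  also have "\<dots> = (\<Sum>u<n. m v u * m u w + m v u + m u w + 1) / 4"
    unfolding sum_divide_distrib by (intro sum.cong refl) (simp add: field_simps)
  finally show ?thesis using vw by (simp add: sum.distrib row_sum col_sum m2_def)
qed

lemma pow3: "v < n \<Longrightarrow> w < n \<Longrightarrow> (zero_one_mat ^\<^sub>m 3) $$ (v, w) = (N\<^sup>2 * m v w + (real n)\<^sup>2) / 8"
proof -
  assume vw: "v < n" "w < n"
  have "zero_one_mat ^\<^sub>m 3 = zero_one_mat ^\<^sub>m 2 * zero_one_mat" by (simp add: numeral_3_eq_3 numeral_2_eq_2)
  then have "(zero_one_mat ^\<^sub>m 3) $$ (v, w) = (\<Sum>u<n. ((m2 v u + n) / 4) * ((m u w + 1) / 2))"
    using vw mult_mat_entry[OF pow_carrier_mat[OF zero_one_mat_carrier] zero_one_mat_carrier vw, of 2] pow2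
    by (simp add: zero_one_mat_entry)
  also have "\<dots> = (\<Sum>u<n. m2 v u * m u w + m2 v u + n * m u w + n) / 8"
    unfolding sum_divide_distrib by (intro sum.cong refl) (simp add: field_simps)
  finally show ?thesis using vw
    by (simp add: sum.distrib m2_row_sum m2_m col_sum power2_eq_square flip: sum_distrib_left)
qed

lemma pow4: "v < n \<Longrightarrow> w < n \<Longrightarrow> (zero_one_mat ^\<^sub>m 4) $$ (v, w) = (N\<^sup>2 * m2 v w + (real n) ^ 3) / 16"
proof -
  assume vw: "v < n" "w < n"
  have "zero_one_mat ^\<^sub>m 4 = zero_one_mat ^\<^sub>m 3 * zero_one_mat" by (simp add: eval_nat_numeral)
  then have "(zero_one_mat ^\<^sub>m 4) $$ (v, w) = (\<Sum>u<n. ((N\<^sup>2 * m v u + (real n)\<^sup>2) / 8) * ((m u w + 1) / 2))"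
    using vw mult_mat_entry[OF pow_carrier_mat[OF zero_one_mat_carrier] zero_one_mat_carrier vw, of 3] pow3
    by (simp add: zero_one_mat_entry)
  also have "\<dots> = (\<Sum>u<n. N\<^sup>2 * (m v u * m u w) + N\<^sup>2 * m v u + (real n)\<^sup>2 * m u w + (real n)\<^sup>2) / 16"
    unfolding sum_divide_distrib by (intro sum.cong refl) (simp add: field_simps)
  finally show ?thesis using vw
    by (simp add: sum.distrib row_sum col_sum m2_def power3_eq_cube power2_eq_square
        flip: sum_distrib_left)
qed

lemma m2_diag: "v < n \<Longrightarrow> m2 v v = n"
proof -
  assume v: "v < n"
  have "m2 v v = (\<Sum>u<n. 1)"
    unfolding m2_def
  proof (intro sum.cong refl)
    fix u assume "u \<in> {..<n}"
    then show "m v u * m u v = 1" using sign[OF v, of u] by (auto simp: sym[of u v])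
  qed
  then show ?thesis by simp
qed

text \<open>
  By the polynomial relation between the first four powers, every eigenvalue \<open>b\<close> is \<open>0\<close>,
  \<open>\<plusminus>N / 2\<close> or \<open>n / 2\<close>, so a nonzero one has absolute value at least \<open>N / 2\<close>. The nonzero
  ones are counted by the traces of the second and the fourth power.
\<close>
lemma many_large_singular_values:
  "size (filter_mset (\<lambda>x. N / 2 \<le> x) (singular_values zero_one_mat)) = (real n / N)\<^sup>2 + 1"
proof -
  obtain B U where wit: "similar_mat_wit zero_one_mat B U (transpose_mat U)" and diag: "diagonal_mat B"
    using real_spectral_theorem[OF zero_one_mat_carrier zero_one_mat_sym] by blast
  have B: "B \<in> carrier_mat n n" using similar_mat_witD2[OF zero_one_mat_carrier wit] by simp
  have M: "singular_values zero_one_mat = mset (map abs (diag_mat B))"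
    by (rule singular_values_symmetric[OF zero_one_mat_carrier zero_one_mat_sym wit diag])
  define b where "b i = B $$ (i, i)" for i
  have b: "b i = 0 \<or> (b i)\<^sup>2 = N\<^sup>2 / 4 \<or> b i = n / 2" if "i < n" for i
  proof -
    \<comment> \<open>coefficients of \<open>x * (x\<^sup>2 - N\<^sup>2 / 4) * (x - n / 2)\<close>\<close>
    define c where "c = (\<lambda>k. [0, n * N\<^sup>2 / 8, - N\<^sup>2 / 4, - real n / 2, 1] ! k)"
    have "(\<Sum>k\<in>{1,2,3,4}. c k * (zero_one_mat ^\<^sub>m k) $$ (v, w)) = 0" if "v < n" "w < n" for v w
      using that zero_one_mat_carrier
      by (simp add: c_def zero_one_mat_entry pow2 pow3 pow4 field_simps power2_eq_square power3_eq_cube)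
    from diagonal_root_of_annihilator[OF zero_one_mat_carrier wit diag this \<open>i < n\<close>]
    have "b i * ((b i)\<^sup>2 - N\<^sup>2 / 4) * (b i - n / 2) = 0"
      by (simp add: c_def b_def field_simps power2_eq_square power3_eq_cube power4_eq_xxxx)
    then show ?thesis by auto
  qed
  have sq: "(\<Sum>i<n. (b i)\<^sup>2) = (real n)\<^sup>2 / 2"
    unfolding b_def sum_pow_mat_diag[OF zero_one_mat_carrier wit diag, symmetric]
    by (simp add: pow2 m2_diag power2_eq_square)
  have fourth: "(\<Sum>i<n. (b i) ^ 4) = (N\<^sup>2 * (real n)\<^sup>2 + (real n) ^ 4) / 16"
    unfolding b_def sum_pow_mat_diag[OF zero_one_mat_carrier wit diag, symmetric]
    by (simp add: pow4 m2_diag power2_eq_square power3_eq_cube power4_eq_xxxx algebra_simps)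
  have n: "0 < real n" using N by linarith
  \<comment> \<open>the even polynomial \<open>1 - (1 - x\<^sup>2 / (N / 2)\<^sup>2) * (1 - x\<^sup>2 / (n / 2)\<^sup>2)\<close>: 0 at 0 and 1 at the other eigenvalues\<close>
  define p where "p x = (4 * (N\<^sup>2 + (real n)\<^sup>2) * x\<^sup>2 - 16 * x ^ 4) / (N\<^sup>2 * (real n)\<^sup>2)" for x
  have p: "(if N / 2 \<le> \<bar>b i\<bar> then 1 else 0) = p (b i)" if "i < n" for i
    using b[OF that]
  proof (elim disjE)
    assume "b i = 0"
    then show ?thesis using N by (simp add: p_def)
  next
    assume h: "(b i)\<^sup>2 = N\<^sup>2 / 4"
    have "(b i) ^ 4 = (N\<^sup>2 / 4)\<^sup>2" unfolding h[symmetric] by simp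
    from h have "\<bar>b i\<bar>\<^sup>2 = (N / 2)\<^sup>2" by (simp add: power2_eq_square)
    then have "\<bar>b i\<bar> = N / 2" by (rule power2_eq_imp_eq) (use N in auto)
    moreover have "p (b i) = (4 * (N\<^sup>2 + (real n)\<^sup>2) * (N\<^sup>2 / 4) - 16 * (N\<^sup>2 / 4)\<^sup>2) / (N\<^sup>2 * (real n)\<^sup>2)"
      unfolding p_def h \<open>(b i) ^ 4 = (N\<^sup>2 / 4)\<^sup>2\<close> ..
    ultimately show ?thesis using N n by (simp add: field_simps power2_eq_square)
  next
    assume h: "b i = n / 2"
    have "p (b i) = 1"
      unfolding h p_def using N n by (simp add: field_simps power2_eq_square power4_eq_xxxx)
    moreover have "N / 2 \<le> \<bar>b i\<bar>" using h N by simp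
    ultimately show ?thesis by simp
  qed
  have "size (filter_mset (\<lambda>x. N / 2 \<le> x) (singular_values zero_one_mat)) = card {i. i < n \<and> N / 2 \<le> \<bar>b i\<bar>}"
    using B by (simp add: M diag_mat_def filter_map o_def b_def mset_filter[symmetric]
        length_filter_conv_card cong: conj_cong del: mset_map mset_filter)
  also have "real \<dots> = (\<Sum>i<n. if N / 2 \<le> \<bar>b i\<bar> then 1 else 0)"
    by (simp add: sum.If_cases Int_def)
  also have "\<dots> = (\<Sum>i<n. p (b i))" using p by simp
  also have "\<dots> = (4 * (N\<^sup>2 + (real n)\<^sup>2) * (\<Sum>i<n. (b i)\<^sup>2) - 16 * (\<Sum>i<n. (b i) ^ 4)) / (N\<^sup>2 * (real n)\<^sup>2)"
    by (simp add: p_def sum_subtractf sum_distrib_left flip: sum_divide_distrib)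
  also have "\<dots> = (real n / N)\<^sup>2 + 1"
    unfolding sq fourth using N n by (simp add: field_simps power2_eq_square power4_eq_xxxx)
  finally show ?thesis by simp
qed

end

section \<open>Kharaghani's block matrices over Rademacher functions\<close>

text \<open>
  Restricted to \<open>{..<2 ^ s}\<close>, the functions with \<open>r < s\<close> are the vectors \<open>h\<^sub>r\<close>. They are defined
  on all natural numbers, so that a block \<open>{l * 2 ^ s..<(l + 1) * 2 ^ s}\<close> of indices can be used
  without reducing its elements modulo \<open>2 ^ s\<close>.
\<close>
definition rademacher :: "nat \<Rightarrow> nat \<Rightarrow> real" where
  "rademacher r v = (if bit v r then -1 else 1)"

lemma rademacher_sq: "rademacher r v * rademacher r v = 1"
  by (simp add: rademacher_def)

lemma rademacher_add_mult: "r < s \<Longrightarrow> rademacher r (l * 2 ^ s + c) = rademacher r c"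
proof -
  assume r: "r < s"
  have "bit x r \<longleftrightarrow> bit (x mod 2 ^ s) r" for x :: nat
    using r by (simp add: bit_take_bit_iff flip: take_bit_eq_mod)
  from this[of "l * 2 ^ s + c"] this[of c] show ?thesis
    by (simp add: rademacher_def)
qed

text \<open>
  Flipping one binary digit permutes \<open>{..<2 ^ s}\<close>. The sums that express orthogonality change sign
  under the flip, so they vanish.
\<close>
lemma sum_eq_0_if_flip_bit_negates:
  fixes f :: "nat \<Rightarrow> real"
  assumes r: "r < s" and f: "\<And>c. f (flip_bit r c) = - f c"
  shows "(\<Sum>c<2 ^ s. f c) = 0"
proof -
  have less: "flip_bit r c < 2 ^ s" if "c < 2 ^ s" for c :: nat
  proof -
    have "take_bit s (flip_bit r c) = flip_bit r c"
      using that r by (simp add: take_bit_flip_bit_eq take_bit_nat_eq_self)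
    then show ?thesis by (metis take_bit_nat_less_exp)
  qed
  have inv: "flip_bit r (flip_bit r c) = c" for c :: nat
    by (rule bit_eqI) (auto simp: bit_flip_bit_iff)
  have "(\<Sum>c<2 ^ s. f c) = (\<Sum>c<2 ^ s. f (flip_bit r c))"
    by (rule sum.reindex_bij_witness[of _ "flip_bit r" "flip_bit r"]) (auto simp: less inv)
  then show ?thesis by (simp add: f sum_negf)
qed

lemma rademacher_flip_bit:
  "rademacher q (flip_bit r c) = (if q = r then - rademacher q c else rademacher q c)"
  by (auto simp: rademacher_def bit_flip_bit_iff)

lemma sum_rademacher: "r < s \<Longrightarrow> (\<Sum>c<2 ^ s. rademacher r c) = 0"
  by (rule sum_eq_0_if_flip_bit_negates) (auto simp: rademacher_flip_bit)

lemma rademacher_orthogonal: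
  assumes "r < s" 
  shows "(\<Sum>c<2 ^ s. rademacher r c * rademacher q c) = (if r = q then 2 ^ s else 0)"
proof (cases "r = q")
  case False
  have "(\<Sum>c<2 ^ s. rademacher r c * rademacher q c) = 0"
    by (rule sum_eq_0_if_flip_bit_negates[OF assms]) (use False in \<open>auto simp: rademacher_flip_bit\<close>)
  then show ?thesis using False by simp
qed (simp add: rademacher_sq)

lemma sum_blocks:
  fixes f :: "nat \<Rightarrow> 'a :: comm_monoid_add"
  shows "(\<Sum>v<s * N. f v) = (\<Sum>l<s. \<Sum>c<N. f (l * N + c))"
proof -
  have "(\<Sum>v<s * N. f v) = (\<Sum>l<s. sum f {l * N..<l * N + N})"
    by (rule sum.nat_group[symmetric])
  also have "\<dots> = (\<Sum>l<s. \<Sum>c<N. f (l * N + c))"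
  proof (rule sum.cong[OF refl])
    fix l
    show "sum f {l * N..<l * N + N} = (\<Sum>c<N. f (l * N + c))"
      using sum.shift_bounds_nat_ivl[of f 0 "l * N" N] by (simp add: lessThan_atLeast0 add.commute)
  qed
  finally show ?thesis .
qed

text \<open>
  The sign matrix \<open>M\<close> of order \<open>s * 2 ^ s\<close>, with block row \<open>i\<close> and block column \<open>j\<close>. The sign
  of the diagonal blocks is chosen to make every diagonal entry \<open>-1\<close>, which excludes loops in the
  graph; it cancels in all products that matter.
\<close>
definition kharaghani :: "nat \<Rightarrow> nat \<Rightarrow> nat \<Rightarrow> real" where
  "kharaghani s v w = (let i = v div 2 ^ s; j = w div 2 ^ s; r = (i + j) mod s
     in (if i = j then -1 else 1) * rademacher r v * rademacher r w)"

definition kharaghani_graph :: "nat \<Rightarrow> nat pair_pre_digraph" where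
  "kharaghani_graph s = \<lparr>pverts = {..<s * 2 ^ s},
     parcs = {(v, w). v < s * 2 ^ s \<and> w < s * 2 ^ s \<and> kharaghani s v w = 1}\<rparr>"

lemma kharaghani_sym: "kharaghani s v w = kharaghani s w v"
  by (simp add: kharaghani_def Let_def add.commute)

lemma kharaghani_sign: "kharaghani s v w = 1 \<or> kharaghani s v w = -1"
  by (simp add: kharaghani_def Let_def rademacher_def)

lemma kharaghani_diag: "kharaghani s v v = -1"
  by (simp add: kharaghani_def Let_def rademacher_def)

lemma block_index_less: "v < s * 2 ^ s \<Longrightarrow> v div 2 ^ s < s"
  by (simp add: less_mult_imp_div_less)

lemma pair_graph_kharaghani: "pair_graph (kharaghani_graph s)"
proof
  show "finite (parcs (kharaghani_graph s))"
    by (rule finite_subset[of _ "{..<s * 2 ^ s} \<times> {..<s * 2 ^ s}"]) (auto simp: kharaghani_graph_def)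
  show "symmetric (with_proj (kharaghani_graph s))"
    by (auto simp: symmetric_def kharaghani_graph_def kharaghani_sym intro!: symI)
qed (auto simp: kharaghani_graph_def kharaghani_diag)

context
  fixes s :: nat
  assumes s: "0 < s"
begin

lemma kharaghani_block:
  assumes "c < 2 ^ s"
  shows "kharaghani s v (l * 2 ^ s + c) = (if v div 2 ^ s = l then -1 else 1) *
    rademacher ((v div 2 ^ s + l) mod s) v * rademacher ((v div 2 ^ s + l) mod s) c"
  using assms s by (simp add: kharaghani_def Let_def rademacher_add_mult)

text \<open>
  The Latin square property: blocks in one column and different rows carry different vectors.
\<close>
lemma mod_add_right_cancel:
  assumes "i < s" "j < s"
  shows "(i + l) mod s = (j + l) mod s \<longleftrightarrow> i = j"
proof
  assume "(i + l) mod s = (j + l) mod s"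
  then have "[i + l = j + l] (mod s)" by (simp add: cong_def)
  then have "[i = j] (mod s)" by (simp add: cong_add_rcancel_nat)
  then show "i = j" using assms by (simp add: cong_def)
qed simp

lemma kharaghani_row_sum: "(\<Sum>w<s * 2 ^ s. kharaghani s v w) = 0"
proof -
  have "(\<Sum>w<s * 2 ^ s. kharaghani s v w) = (\<Sum>l<s. \<Sum>c<2 ^ s. (if v div 2 ^ s = l then -1 else 1) *
    rademacher ((v div 2 ^ s + l) mod s) v * rademacher ((v div 2 ^ s + l) mod s) c)"
    unfolding sum_blocks by (intro sum.cong refl) (simp add: kharaghani_block)
  also have "\<dots> = 0"
    using s by (simp add: sum_rademacher flip: sum_distrib_left)
  finally show ?thesis .
qed

text \<open>
  \<open>M\<^sup>2\<close> is block diagonal: by the Latin square property, blocks in different block rows meet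
  only orthogonal vectors.
\<close>
lemma kharaghani_square:
  assumes v: "v < s * 2 ^ s" and w: "w < s * 2 ^ s"
  shows "(\<Sum>u<s * 2 ^ s. kharaghani s v u * kharaghani s u w) =
    (if v div 2 ^ s = w div 2 ^ s
     then 2 ^ s * (\<Sum>l<s. rademacher ((v div 2 ^ s + l) mod s) v * rademacher ((v div 2 ^ s + l) mod s) w)
     else 0)"
proof -
  let ?i = "v div 2 ^ s" and ?j = "w div 2 ^ s"
  let ?h = "\<lambda>i l. rademacher ((i + l) mod s)" and ?e = "\<lambda>i l :: nat. if i = l then -1 else 1 :: real"
  have "(\<Sum>u<s * 2 ^ s. kharaghani s v u * kharaghani s u w) =
      (\<Sum>l<s. \<Sum>c<2 ^ s. ?e ?i l * ?e ?j l * ?h ?i l v * ?h ?j l w * (?h ?i l c * ?h ?j l c))"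
    unfolding sum_blocks kharaghani_sym[of s _ w]
    by (intro sum.cong refl) (simp add: kharaghani_block)
  also have "\<dots> = (\<Sum>l<s. ?e ?i l * ?e ?j l * ?h ?i l v * ?h ?j l w * (if ?i = ?j then 2 ^ s else 0))"
    using s by (simp add: rademacher_orthogonal mod_add_right_cancel block_index_less[OF v] block_index_less[OF w]
        flip: sum_distrib_left)
  also have "\<dots> = (if ?i = ?j then 2 ^ s * (\<Sum>l<s. ?h ?i l v * ?h ?i l w) else 0)"
    by (auto simp: sum_distrib_left intro!: sum.cong)
  finally show ?thesis .
qed

text \<open>
  Block \<open>i\<close> of \<open>M\<^sup>2\<close> is \<open>N\<close> times the sum of all \<open>h\<^sub>p h\<^sub>p\<^sup>T\<close>. Multiplied by the block
  \<open>h\<^sub>r h\<^sub>r\<^sup>T\<close> with \<open>r = (i + j) mod s\<close>, only the term \<open>p = r\<close> survives, with a second factor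
  \<open>N\<close>.
\<close>
lemma kharaghani_cube:
  assumes v: "v < s * 2 ^ s" and w: "w < s * 2 ^ s"
  shows "(\<Sum>u<s * 2 ^ s. (\<Sum>t<s * 2 ^ s. kharaghani s v t * kharaghani s t u) * kharaghani s u w)
    = (2 ^ s)\<^sup>2 * kharaghani s v w"
proof -
  let ?i = "v div 2 ^ s" and ?j = "w div 2 ^ s"
  let ?h = "\<lambda>i l. rademacher ((i + l) mod s)" and ?e = "\<lambda>i l :: nat. if i = l then -1 else 1 :: real"
  have "(\<Sum>u<s * 2 ^ s. (\<Sum>t<s * 2 ^ s. kharaghani s v t * kharaghani s t u) * kharaghani s u w)
    = (\<Sum>u<s * 2 ^ s. (if ?i = u div 2 ^ s then 2 ^ s * (\<Sum>p<s. ?h ?i p v * ?h ?i p u) else 0)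
          * kharaghani s w u)"
    by (intro sum.cong refl) (simp add: kharaghani_square[OF v] kharaghani_sym[of s _ w])
  also have "\<dots> = (\<Sum>l<s. \<Sum>c<2 ^ s. (if ?i = l then 2 ^ s * (\<Sum>p<s. ?h ?i p v * ?h ?i p c) else 0)
          * (?e ?j l * ?h ?j l w * ?h ?j l c))"
    unfolding sum_blocks using s
    by (intro sum.cong refl) (simp add: kharaghani_block rademacher_add_mult)
  also have "\<dots> = (\<Sum>l<s. if l = ?i then \<Sum>c<2 ^ s. 2 ^ s * (\<Sum>p<s. ?h ?i p v * ?h ?i p c)
          * (?e ?j ?i * ?h ?j ?i w * ?h ?j ?i c) else 0)"
    by (intro sum.cong refl) auto
  also have "\<dots> = (\<Sum>c<2 ^ s. 2 ^ s * (\<Sum>p<s. ?h ?i p v * ?h ?i p c) * (?e ?j ?i * ?h ?j ?i w * ?h ?j ?i c))"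
    using block_index_less[OF v] by (simp add: sum.delta)
  also have "\<dots> = (\<Sum>c<2 ^ s. \<Sum>p<s. 2 ^ s * ?e ?j ?i * ?h ?j ?i w * ?h ?i p v * (?h ?i p c * ?h ?j ?i c))"
    by (simp add: sum_distrib_left sum_distrib_right mult_ac)
  also have "\<dots> = (\<Sum>p<s. \<Sum>c<2 ^ s. 2 ^ s * ?e ?j ?i * ?h ?j ?i w * ?h ?i p v * (?h ?i p c * ?h ?j ?i c))"
    by (rule sum.swap)
  also have "\<dots> = (\<Sum>p<s. 2 ^ s * ?e ?j ?i * ?h ?j ?i w * ?h ?i p v * (if p = ?j then 2 ^ s else 0))"
  proof (intro sum.cong refl)
    fix p assume "p \<in> {..<s}"
    then have "(?i + p) mod s = (?j + ?i) mod s \<longleftrightarrow> p = ?j"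
      using mod_add_right_cancel[of p ?j ?i] block_index_less[OF w] by (simp add: add.commute)
    then show "(\<Sum>c<2 ^ s. 2 ^ s * ?e ?j ?i * ?h ?j ?i w * ?h ?i p v * (?h ?i p c * ?h ?j ?i c))
      = 2 ^ s * ?e ?j ?i * ?h ?j ?i w * ?h ?i p v * (if p = ?j then 2 ^ s else 0)"
      using s rademacher_orthogonal[of "(?i + p) mod s" s "(?j + ?i) mod s"]
      by (simp flip: sum_distrib_left)
  qed
  also have "\<dots> = (\<Sum>p<s. if p = ?j then 2 ^ s * ?e ?j ?i * ?h ?j ?i w * ?h ?i p v * 2 ^ s else 0)"
    by (intro sum.cong refl) simp
  also have "\<dots> = 2 ^ s * ?e ?j ?i * ?h ?j ?i w * ?h ?i ?j v * 2 ^ s"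
    using block_index_less[OF w] by (simp add: sum.delta)
  also have "\<dots> = (2 ^ s)\<^sup>2 * kharaghani s v w"
    by (simp add: kharaghani_def Let_def power2_eq_square add.commute)
  finally show ?thesis .
qed

lemma sign_matrix_kharaghani: "sign_matrix (kharaghani s) (s * 2 ^ s) (2 ^ s)"
proof
  show "(2::real) ^ s \<le> real (s * 2 ^ s)" using s by simp
  show "kharaghani s v w = kharaghani s w v" for v w by (rule kharaghani_sym)
qed (simp_all add: kharaghani_sign kharaghani_row_sum kharaghani_cube)

lemma adjacency_matrix_kharaghani:
  "adjacency_matrix (kharaghani_graph s) = sign_matrix.zero_one_mat (kharaghani s) (s * 2 ^ s)"
proof -
  have entry: "(kharaghani s v w + 1) / 2 = (if kharaghani s v w = 1 then 1 else 0)" for v w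
    using kharaghani_sign[of s v w] by auto
  have "sorted_list_of_set {..<s * 2 ^ s} = [0..<s * 2 ^ s]"
    unfolding lessThan_atLeast0 by (rule sorted_list_of_set_range)
  then show ?thesis
    unfolding sign_matrix.zero_one_mat_def[OF sign_matrix_kharaghani] entry
    by (intro eq_matI) (simp_all add: adjacency_matrix_def kharaghani_graph_def Let_def)
qed

lemma kharaghani_graph_singular_value:
  assumes k: "0 < k" "k \<le> s\<^sup>2 + 1"
  shows "1 / (2 * real s) \<le> graph_singular_value (kharaghani_graph s) k / card (pverts (kharaghani_graph s))"
proof -
  let ?M = "singular_values (adjacency_matrix (kharaghani_graph s))"
  have "real (size (filter_mset (\<lambda>x. 2 ^ s / 2 \<le> x) ?M)) = (real (s * 2 ^ s) / 2 ^ s)\<^sup>2 + 1"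
    unfolding adjacency_matrix_kharaghani
    by (rule sign_matrix.many_large_singular_values[OF sign_matrix_kharaghani])
  also have "\<dots> = real (s\<^sup>2 + 1)" by simp
  finally have "k \<le> size (filter_mset (\<lambda>x. 2 ^ s / 2 \<le> x) ?M)" using k by linarith
  then have "2 ^ s / 2 \<le> graph_singular_value (kharaghani_graph s) k"
    unfolding graph_singular_value_eq_nth_largest by (rule nth_largest_ge[OF k(1)])
  then have "2 ^ s / 2 / (real s * 2 ^ s) \<le> graph_singular_value (kharaghani_graph s) k / (real s * 2 ^ s)"
    by (rule divide_right_mono) simp
  then show ?thesis using s by (simp add: kharaghani_graph_def)
qed

end

section \<open>Bounds on \<open>c_star\<close>\<close>

text \<open>
  For the lower bound take \<open>s = \<lceil>sqrt (k - 1)\<rceil>\<close>: then \<open>k \<le> s\<^sup>2 + 1\<close>, and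
  \<open>2 * s < 2 * sqrt (k - 1) + 2\<close> is the source of strictness.
\<close>
lemma c_star_bounds:
  assumes k: "3 \<le> k"
  shows "c_star k \<le> 1 / (2 * sqrt (real k - 1))" and "1 / (2 * sqrt (real k - 1) + 2) < c_star k"
proof -
  let ?S = "{graph_singular_value G k / real (card (pverts G)) |
                   G :: nat pair_pre_digraph. pair_graph G \<and> card (pverts G) \<ge> k}"
  have upper: "x \<le> 1 / (2 * sqrt (real k - 1))" if "x \<in> ?S" for x
    using that graph_singular_value_ratio_le[where k = k] k by auto
  define s where "s = nat \<lceil>sqrt (real k - 1)\<rceil>"
  have root: "1 < sqrt (real k - 1)" using k by (simp add: real_less_rsqrt)
  then have s: "sqrt (real k - 1) \<le> real s" "real s < sqrt (real k - 1) + 1"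
    unfolding s_def by linarith+
  have "0 < s" using root s by linarith
  have "real k - 1 \<le> (real s)\<^sup>2"
    using s(1) by (rule sqrt_le_D)
  then have "real k \<le> real (s\<^sup>2 + 1)" by simp
  then have ks: "k \<le> s\<^sup>2 + 1" by linarith
  also have "\<dots> \<le> s * (s + 1)" using \<open>0 < s\<close> by (simp add: power2_eq_square)
  also have "\<dots> \<le> s * 2 ^ s" by (intro mult_left_mono) (simp_all add: Suc_leI)
  finally have "k \<le> card (pverts (kharaghani_graph s))" by (simp add: kharaghani_graph_def)
  then have mem: "graph_singular_value (kharaghani_graph s) k / real (card (pverts (kharaghani_graph s))) \<in> ?S"
    using pair_graph_kharaghani by blast
  show "c_star k \<le> 1 / (2 * sqrt (real k - 1))"
    unfolding c_star_def by (rule cSup_least[OF _ upper]) (use mem in blast)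
  have "1 / (2 * sqrt (real k - 1) + 2) < 1 / (2 * real s)"
    using s \<open>0 < s\<close> by (intro frac_less2) simp_all
  also have "\<dots> \<le> graph_singular_value (kharaghani_graph s) k / real (card (pverts (kharaghani_graph s)))"
    using k by (intro kharaghani_graph_singular_value[OF \<open>0 < s\<close> _ ks]) simp
  also have "\<dots> \<le> c_star k"
    unfolding c_star_def by (rule cSup_upper[OF mem bdd_aboveI[OF upper]])
  finally show "1 / (2 * sqrt (real k - 1) + 2) < c_star k" .
qed

text \<open>
  With \<open>r = sqrt (k - 1)\<close> the difference is \<open>- 2 / ((2 * r + 2) * (2 * r))\<close>, and the denominator is
  at least \<open>4 * (k - 1) \<ge> 2 * k\<close> for \<open>k \<ge> 2\<close>.
\<close>
lemma c_star_bounds_gap: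
  "(\<lambda>k::nat. 1 / (2 * sqrt (real k - 1) + 2) - 1 / (2 * sqrt (real k - 1))) \<in> O[at_top](\<lambda>k. 1 / real k)"
proof (rule bigoI)
  show "\<forall>\<^sub>F k in at_top. norm (1 / (2 * sqrt (real k - 1) + 2) - 1 / (2 * sqrt (real k - 1)))
      \<le> 1 * norm (1 / real k)"
    using eventually_ge_at_top[of 2]
  proof eventually_elim
    case (elim k)
    define r where "r = sqrt (real k - 1)"
    have r: "1 \<le> r" "r\<^sup>2 = real k - 1" using elim by (simp_all add: r_def)
    let ?d = "(2 * r + 2) * (2 * r)"
    have "1 / (2 * r + 2) - 1 / (2 * r) = - (2 / ?d)"
      using r(1) by (simp add: diff_frac_eq)
    moreover have "?d = 4 * (real k - 1) + 4 * r"
      unfolding r(2)[symmetric] by (simp add: algebra_simps power2_eq_square)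
    then have "2 * real k \<le> ?d" using r(1) elim by simp
    then have "2 / ?d \<le> 2 / (2 * real k)"
      using elim by (intro frac_le) auto
    moreover have "0 \<le> 2 / ?d" using r(1) by simp
    ultimately show ?case unfolding r_def[symmetric] by simp
  qed
qed

theorem theorem2p27:
  shows "(\<forall>k::nat. k \<ge> 3 \<longrightarrow>
            1 / (2 * sqrt (real k - 1)) \<ge> c_star k \<and>
            c_star k > 1 / (2 * sqrt (real k - 1) + 2)) \<and>
         (\<lambda>k::nat. 1 / (2 * sqrt (real k - 1) + 2) - 1 / (2 * sqrt (real k - 1)))
            \<in> O[at_top](\<lambda>k. 1 / real k)"
  using c_star_bounds c_star_bounds_gap by blast

end
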